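(* Let $\mathbb{F}$ be a normed field of characteristic zero, and let $\mathfrak{A}$ be a complete metric $\mathbb{F}$-algebra. If $\mathfrak{A}$ is nil, then $\mathfrak{A}$ is nilpotent.
   Context: Algebras are associative and not necessarily unital. An algebra $\mathfrak{A}$ is nil if for every $a\in\mathfrak{A}$ there is a positive integer $n$ (depending on $a$) with $a^n=0$; it is nilpotent if there is a positive integer $n$ with $\mathfrak{A}^n=\{0\}$, i.e. $a_1a_2\cdots a_n=0$ for all $a_1,\dots,a_n\in\mathfrak{A}$. A normed field is a field $\mathbb{F}$ equipped with a map $|\cdot|:\mathbb{F}\to\mathbb{R}_{\geq 0}$ having the usual properties of a norm ($|\lambda|=0$ iff $\lambda=0$, and $|\lambda+\mu|\leq|\lambda|+|\mu|$) and satisfying $|-\lambda|=|\lambda|$ and $|\lambda\mu|\leq|\lambda|\cdot|\mu|$ for all $\lambda,\mu\in\mathbb{F}$. When $\mathrm{char}(\mathbb{F})=0$, it is moreover assumed, as part of the definition, that $|n\cdot\lambda|=n\cdot|\lambda|$ for all $n\in\mathbb{N}$ and $\lambda\in\mathbb{F}$. Let $\mathbb{F}$ be a normed field. A metric $\mathbb{F}$-algebra is an associative $\mathbb{F}$-algebra $\mathfrak{A}$ which is also a metric space $(\mathfrak{A},\mathsf{d})$, such that there is a real number $\gamma>0$ with: (i) $\mathsf{d}(a+c,b+c)\leq\gamma\,\mathsf{d}(a,b)$ for all $a,b,c\in\mathfrak{A}$; (ii) $\mathsf{d}(\lambda a,\lambda b)\leq\gamma|\lambda|\,\mathsf{d}(a,b)$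 for all $\lambda\in\mathbb{F}$, $a,b\in\mathfrak{A}$; (iii) $\mathsf{d}(ac,bc)\leq\gamma\,\mathsf{d}(c,0)\,\mathsf{d}(a,b)$ and $\mathsf{d}(ca,cb)\leq\gamma\,\mathsf{d}(c,0)\,\mathsf{d}(a,b)$ for all $a,b,c\in\mathfrak{A}$. It is a complete metric $\mathbb{F}$-algebra if $(\mathfrak{A},\mathsf{d})$ is a complete metric space. *)

theory Defs
  imports "HOL-Analysis.Analysis"
begin

locale normed_field =
  fixes nrm :: "'f::field \<Rightarrow> real"
  assumes nrm_nonneg: "0 \<le> nrm x"
    and nrm_eq_0_iff: "nrm x = 0 \<longleftrightarrow> x = 0"
    and nrm_triangle: "nrm (x + y) \<le> nrm x + nrm y"
    and nrm_minus: "nrm (- x) = nrm x"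
    and nrm_mult_le: "nrm (x * y) \<le> nrm x * nrm y"
    and nrm_of_nat_mult: "CHAR('f) = 0 \<Longrightarrow> nrm (of_nat n * x) = of_nat n * nrm x"

text \<open>Class \<open>ring\<close> is that of associative, not necessarily unital rings. Classes \<open>ring\<close> and
  \<open>metric_space\<close> are combined without any compatibility; this is what \<open>metric_bounds\<close> provides.\<close>

locale assoc_algebra = vector_space scale
  for scale :: "'f::field \<Rightarrow> 'a::ring \<Rightarrow> 'a" +
  assumes scale_mult_left: "scale r a * b = scale r (a * b)"
    and scale_mult_right: "a * scale r b = scale r (a * b)"

locale metric_algebra = normed_field nrm + assoc_algebra scale
  for nrm :: "'f::field \<Rightarrow> real"
    and scale :: "'f \<Rightarrow> 'a::{ring, metric_space} \<Rightarrow> 'a" +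
  assumes metric_bounds:
    "\<exists>\<gamma>>0.
       (\<forall>a b c :: 'a. dist (a + c) (b + c) \<le> \<gamma> * dist a b) \<and>
       (\<forall>r. \<forall>a b :: 'a. dist (scale r a) (scale r b) \<le> \<gamma> * nrm r * dist a b) \<and>
       (\<forall>a b c :: 'a. dist (a * c) (b * c) \<le> \<gamma> * dist c 0 * dist a b) \<and>
       (\<forall>a b c :: 'a. dist (c * a) (c * b) \<le> \<gamma> * dist c 0 * dist a b)"

locale complete_metric_algebra = metric_algebra nrm scale
  for nrm :: "'f::field \<Rightarrow> real"
    and scale :: "'f \<Rightarrow> 'a::{ring, metric_space} \<Rightarrow> 'a" +
  assumes complete_algebra: "complete (UNIV :: 'a set)"

text \<open>Without a unit there are no empty products (so \<open>prod_list\<close> and \<open>^\<close> are not available);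
  the product of the empty list is left unspecified.\<close>

fun nonempty_prod :: "'a::semigroup_mult list \<Rightarrow> 'a" where
  "nonempty_prod [x] = x"
| "nonempty_prod (x # y # ys) = x * nonempty_prod (y # ys)"

definition nil_algebra :: "'a::ring itself \<Rightarrow> bool" where
  "nil_algebra _ \<longleftrightarrow> (\<forall>a :: 'a. \<exists>n>0. nonempty_prod (replicate n a) = 0)"

definition nilpotent_algebra :: "'a::ring itself \<Rightarrow> bool" where
  "nilpotent_algebra _ \<longleftrightarrow>
     (\<exists>n>0. \<forall>xs :: 'a list. length xs = n \<longrightarrow> nonempty_prod xs = 0)"

end

theory Submission
  imports Defs
begin

text \<open>
  By Baire's theorem one of the closed sets \<open>{x. x ^ n = 0}\<close> contains a ball around some \<open>a\<close>.
  For every \<open>b\<close>, the points \<open>a + 2 ^ (- m) b\<close> lie in this ball for large \<open>m\<close>, so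
  the polynomial \<open>t \<mapsto> (a + t b) ^ n\<close> has infinitely many zeros; hence its leading coefficient \<open>b ^ n\<close>
  vanishes and the algebra is nil of bounded index. What remains is the Nagata-Higman theorem, proved
  by induction on \<open>n\<close> in the relative form ``if \<open>x ^ n\<close> lies in an ideal \<open>I\<close> for all \<open>x\<close>, then so do all
  sufficiently long products''. Linearising \<open>x ^ n\<close> and applying the result twice gives Higman's relation
  \<open>x ^ (n - 1) z y ^ (n - 1) \<in> I\<close>; the induction hypothesis, applied to suitable annihilators modulo \<open>I\<close>,
  replaces first the left and then the right power by arbitrary long products.
\<close>

section \<open>Products and powers without a unit\<close>

lemma nonempty_prod_Cons: "xs \<noteq> [] \<Longrightarrow> nonempty_prod (x # xs) = x * nonempty_prod xs"
  by (cases xs) auto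

lemma nonempty_prod_append:
  "xs \<noteq> [] \<Longrightarrow> ys \<noteq> [] \<Longrightarrow> nonempty_prod (xs @ ys) = nonempty_prod xs * nonempty_prod ys"
proof (induction xs)
  case (Cons x xs)
  then show ?case by (cases "xs = []") (simp_all add: nonempty_prod_Cons mult.assoc)
qed simp

text \<open>The exponent is shifted by one: \<open>spow x n\<close> is \<open>x ^ (n + 1)\<close>.\<close>

primrec spow :: "'a::semigroup_mult \<Rightarrow> nat \<Rightarrow> 'a" where
  "spow x 0 = x"
| "spow x (Suc n) = x * spow x n"

lemma nonempty_prod_replicate: "nonempty_prod (replicate (Suc n) x) = spow x n"
  by (induction n) simp_all

text \<open>Operators stand in for factors \<open>x ^ i\<close>: at \<open>i = 0\<close> they are
  the identity, which makes up for the missing unit.\<close>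

abbreviation lmul :: "'a::semigroup_mult \<Rightarrow> nat \<Rightarrow> 'a \<Rightarrow> 'a" where
  "lmul x i \<equiv> ((*) x) ^^ i"

abbreviation rmul :: "'a::semigroup_mult \<Rightarrow> nat \<Rightarrow> 'a \<Rightarrow> 'a" where
  "rmul x i \<equiv> (\<lambda>z. z * x) ^^ i"

lemma lmul_mult: "lmul x i (y * z) = lmul x i y * z"
  by (induction i) (simp_all add: mult.assoc)

lemma rmul_mult: "rmul x i (y * z) = y * rmul x i z"
  by (induction i) (simp_all add: mult.assoc)

lemma lmul_rmul_commute: "lmul x i (rmul y j z) = rmul y j (lmul x i z)"
  by (induction i) (simp_all add: rmul_mult)

lemma spow_commute: "spow x n * x = x * spow x n"
  by (induction n) (simp_all add: mult.assoc)

lemma rmul_times: "rmul x i y * z = y * lmul x i z"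
  by (induction i arbitrary: z) (simp_all add: mult.assoc funpow_swap1 lmul_mult)

lemma rmul_Suc_eq: "rmul x (Suc n) z = z * spow x n"
proof (induction n)
  case (Suc n)
  have "rmul x (Suc (Suc n)) z = rmul x (Suc n) z * x"
    by (simp only: funpow.simps o_apply)
  then show ?case by (simp only: Suc mult.assoc spow_commute spow.simps)
qed simp

lemma lmul_Suc_eq: "lmul x (Suc n) z = spow x n * z"
proof (induction n)
  case (Suc n)
  have "lmul x (Suc (Suc n)) z = x * lmul x (Suc n) z"
    by (simp only: funpow.simps o_apply)
  then show ?case by (simp only: Suc mult.assoc spow.simps)
qed simp

lemma rmul_sum: "rmul (x::'a::ring) i (sum f A) = (\<Sum>a\<in>A. rmul x i (f a))"
  by (induction i) (simp_all add: sum_distrib_right)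

lemma lmul_sum: "lmul (x::'a::ring) i (sum f A) = (\<Sum>a\<in>A. lmul x i (f a))"
  by (induction i) (simp_all add: sum_distrib_left)

text \<open>The part of \<open>(a + b) ^ (n + 1)\<close> that is homogeneous of degree \<open>k\<close> in \<open>b\<close>.\<close>

fun binom_part :: "'a::ring \<Rightarrow> 'a \<Rightarrow> nat \<Rightarrow> nat \<Rightarrow> 'a" where
  "binom_part a b 0 k = (if k = 0 then a else if k = 1 then b else 0)"
| "binom_part a b (Suc n) k =
     a * binom_part a b n k + (case k of 0 \<Rightarrow> 0 | Suc j \<Rightarrow> b * binom_part a b n j)"

lemma binom_part_eq_0: "k > Suc n \<Longrightarrow> binom_part a b n k = 0"
  by (induction n arbitrary: k) (auto split: nat.split)

lemma binom_part_0: "binom_part a b n 0 = spow a n"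
  by (induction n) simp_all

lemma binom_part_top: "binom_part a b n (Suc n) = spow b n"
  by (induction n) (simp_all add: binom_part_eq_0)

text \<open>The single \<open>b\<close> has \<open>i\<close> copies of \<open>a\<close> on its left
  and \<open>n - i\<close> on its right; this is the linearised power.\<close>

lemma binom_part_1: "binom_part a b n 1 = (\<Sum>i\<le>n. lmul a i (rmul a (n - i) b))"
proof (induction n)
  case (Suc n)
  have "(\<Sum>i\<le>Suc n. lmul a i (rmul a (Suc n - i) b)) =
      rmul a (Suc n) b + (\<Sum>i\<le>n. a * lmul a i (rmul a (n - i) b))"
    by (subst sum.atMost_Suc_shift) (simp del: funpow.simps(2) add: funpow.simps(2)[of _ "(*) a"])
  then show ?case
    using Suc by (simp add: binom_part_0 rmul_Suc_eq sum_distrib_left del: funpow.simps)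
qed simp

section \<open>Ideals and polynomials with coefficients in the algebra\<close>

definition (in assoc_algebra) ideal :: "'a set \<Rightarrow> bool" where
  "ideal I \<longleftrightarrow> subspace I \<and> (\<forall>a. \<forall>x\<in>I. a * x \<in> I \<and> x * a \<in> I)"

context assoc_algebra
begin

lemma spow_add_scale:
  "spow (a + scale t b) n = (\<Sum>k\<le>Suc n. scale (t ^ k) (binom_part a b n k))"
proof (induction n)
  case 0
  then show ?case by simp
next
  case (Suc n)
  let ?c = "binom_part a b"
  have "spow (a + scale t b) (Suc n) =
      a * (\<Sum>k\<le>Suc n. scale (t ^ k) (?c n k)) + scale t b * (\<Sum>k\<le>Suc n. scale (t ^ k) (?c n k))"
    by (simp add: Suc distrib_right del: sum.atMost_Suc)
  also have "a * (\<Sum>k\<le>Suc n. scale (t ^ k) (?c n k)) = (\<Sum>k\<le>Suc n. scale (t ^ k) (a * ?c n k))"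
    by (simp add: sum_distrib_left scale_mult_right del: sum.atMost_Suc)
  \<comment> \<open>The added top term vanishes; it matches the range of the shifted sum
    below.\<close>
  also have "\<dots> = (\<Sum>k\<le>Suc (Suc n). scale (t ^ k) (a * ?c n k))"
    by (subst (2) sum.atMost_Suc) (simp add: binom_part_eq_0)
  also have "scale t b * (\<Sum>k\<le>Suc n. scale (t ^ k) (?c n k)) =
      (\<Sum>k\<le>Suc n. scale (t ^ Suc k) (b * ?c n k))"
    by (simp add: sum_distrib_left scale_mult_right scale_mult_left mult.commute del: sum.atMost_Suc)
  also have "\<dots> = (\<Sum>k\<le>Suc (Suc n). scale (t ^ k) (case k of 0 \<Rightarrow> 0 | Suc j \<Rightarrow> b * ?c n j))"
    by (subst (2) sum.atMost_Suc_shift) simp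
  finally show ?case
    by (simp add: scale_right_distrib sum.distrib del: sum.atMost_Suc)
qed

text \<open>Comparing the values at \<open>t\<close> and \<open>h t\<close> eliminates the leading coefficient.\<close>

lemma coeff_in_subspace:
  assumes "subspace I" and h: "h \<noteq> 0" "inj (\<lambda>k. h ^ k)"
    and "\<And>m. m \<ge> M \<Longrightarrow> (\<Sum>k\<le>n. scale ((h ^ m) ^ k) (c k)) \<in> I" and "k \<le> n"
  shows "c k \<in> I"
  using assms(4,5)
proof (induction n arbitrary: c k)
  case 0
  have "scale ((h ^ M) ^ 0) (c 0) \<in> I" using 0(1)[of M] by simp
  then show ?case using 0 by simp
next
  case (Suc n)
  let ?p = "\<lambda>m. \<Sum>k\<le>Suc n. scale ((h ^ m) ^ k) (c k)"
  have low: "c k \<in> I" if "k \<le> n" for k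
  proof -
    have "scale (h ^ k - h ^ Suc n) (c k) \<in> I"
    proof (rule Suc.IH[OF _ that])
      fix m assume "m \<ge> M"
      \<comment> \<open>The summand for \<open>Suc n\<close> has scalar factor zero, so it may be
        added.\<close>
      have "(\<Sum>k\<le>n. scale ((h ^ m) ^ k) (scale (h ^ k - h ^ Suc n) (c k))) =
          (\<Sum>k\<le>Suc n. scale ((h ^ m) ^ k) (scale (h ^ k - h ^ Suc n) (c k)))"
        by simp
      also have "\<dots> = ?p (Suc m) - scale (h ^ Suc n) (?p m)"
      proof -
        have "(h ^ m) ^ k * (h ^ k - h ^ Suc n) = (h ^ Suc m) ^ k - h ^ Suc n * (h ^ m) ^ k" for k
          by (simp only: right_diff_distrib power_Suc power_mult_distrib mult.commute)
        then show ?thesis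
          by (simp only: scale_scale) (simp only: scale_left_diff_distrib scale_sum_right
              scale_scale sum_subtractf)
      qed
      also have "\<dots> \<in> I"
        using Suc.prems(1)[of m] Suc.prems(1)[of "Suc m"] \<open>m \<ge> M\<close> assms(1)
        by (intro subspace_diff subspace_scale) auto
      finally show "(\<Sum>k\<le>n. scale ((h ^ m) ^ k) (scale (h ^ k - h ^ Suc n) (c k))) \<in> I" .
    qed
    then have "scale (inverse (h ^ k - h ^ Suc n)) (scale (h ^ k - h ^ Suc n) (c k)) \<in> I"
      using assms(1) by (rule subspace_scale[rotated])
    moreover have "h ^ k - h ^ Suc n \<noteq> 0"
      using injD[OF h(2), of k "Suc n"] that by auto
    ultimately show ?thesis by simp
  qed
  have "c (Suc n) \<in> I"
  proof -
    let ?t = "(h ^ M) ^ Suc n"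
    \<comment> \<open>At \<open>h ^ M\<close> the lower terms lie in \<open>I\<close>, which
      isolates the top one.\<close>
    have "?p M - (\<Sum>k\<le>n. scale ((h ^ M) ^ k) (c k)) \<in> I"
    proof (rule subspace_diff[OF assms(1) Suc.prems(1)[of M]])
      show "(\<Sum>k\<le>n. scale ((h ^ M) ^ k) (c k)) \<in> I"
        using assms(1) low by (intro subspace_sum subspace_scale) auto
    qed simp
    then have "scale ?t (c (Suc n)) \<in> I" by simp
    then have "scale (inverse ?t) (scale ?t (c (Suc n))) \<in> I"
      using assms(1) by (rule subspace_scale[rotated])
    moreover have "inverse ?t * ?t = 1" using h(1) by (intro left_inverse) simp
    ultimately show ?thesis by (simp only: scale_scale scale_one)
  qed
  then show ?case using low Suc.prems(2) le_Suc_eq by blast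
qed

lemma ideal_lmul: "ideal I \<Longrightarrow> x \<in> I \<Longrightarrow> lmul a i x \<in> I"
  by (induction i) (auto simp: ideal_def)

lemma ideal_rmul: "ideal I \<Longrightarrow> x \<in> I \<Longrightarrow> rmul a i x \<in> I"
  by (induction i) (auto simp: ideal_def)

section \<open>The Nagata-Higman theorem\<close>

text \<open>A double sum is read in two ways. For each \<open>j\<close> the sum over
  \<open>i\<close> lies in \<open>I\<close>, and for each \<open>i > 0\<close> so does the sum over
  \<open>j\<close>. What is left is the row \<open>i = 0\<close>, which consists of
  \<open>n + 2\<close> equal terms, and \<open>n + 2\<close> is invertible.\<close>

lemma higman_relation:
  fixes n :: nat
  assumes I: "ideal I" and char: "CHAR('f) = 0"
    and lin: "\<And>x y. (\<Sum>i\<le>Suc n. lmul x i (rmul x (Suc n - i) y)) \<in> I"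
  shows "spow x n * z * spow y n \<in> I"
proof -
  let ?N = "Suc n"
  have sub: "subspace I" using I by (simp add: ideal_def)
  \<comment> \<open>With \<open>N = n + 1\<close>, this is the word
    \<open>x ^ (N - i) z y ^ j x ^ i y ^ (N - j)\<close>.\<close>
  define f where "f i j = rmul y (?N - j) (lmul x (?N - i) (rmul x i (rmul y j z)))" for i j
  have "(\<Sum>j\<le>?N. \<Sum>i\<le>?N. f i j) \<in> I"
  proof (rule subspace_sum[OF sub])
    fix j
    have "(\<Sum>i\<le>?N. f i j) =
        rmul y (?N - j) (\<Sum>i\<le>?N. lmul x (?N - i) (rmul x i (rmul y j z)))"
      by (simp add: f_def rmul_sum del: sum.atMost_Suc)
    also have "(\<Sum>i\<le>?N. lmul x (?N - i) (rmul x i (rmul y j z))) =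
        (\<Sum>i\<le>?N. lmul x i (rmul x (?N - i) (rmul y j z)))"
      by (rule sum.reindex_bij_witness[of _ "\<lambda>i. ?N - i" "\<lambda>i. ?N - i"]) auto
    finally show "(\<Sum>i\<le>?N. f i j) \<in> I"
      using ideal_rmul[OF I lin] by simp
  qed
  then have total: "(\<Sum>i\<le>?N. \<Sum>j\<le>?N. f i j) \<in> I"
    by (subst sum.swap)
  \<comment> \<open>\<open>lin\<close> is applied to \<open>y\<close> and the element
    \<open>x ^ (i + 1)\<close>; in the row \<open>i = 0\<close> there is no such element to
    insert.\<close>
  have pos: "(\<Sum>j\<le>?N. f (Suc i) j) \<in> I" for i
  proof -
    have "f (Suc i) j = lmul x (?N - Suc i) (z * lmul y j (rmul y (?N - j) (spow x i)))" for j
      unfolding f_def lmul_rmul_commute[symmetric] rmul_Suc_eq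
      by (simp add: rmul_times rmul_mult lmul_rmul_commute)
    then have "(\<Sum>j\<le>?N. f (Suc i) j) =
        lmul x (?N - Suc i) (z * (\<Sum>j\<le>?N. lmul y j (rmul y (?N - j) (spow x i))))"
      by (simp add: lmul_sum sum_distrib_left del: sum.atMost_Suc)
    moreover have "z * (\<Sum>j\<le>?N. lmul y j (rmul y (?N - j) (spow x i))) \<in> I"
      using lin[of y "spow x i"] I unfolding ideal_def by blast
    ultimately show ?thesis
      by (simp only: ideal_lmul[OF I])
  qed
  have "f 0 j = spow x n * z * spow y n" if "j \<le> ?N" for j
  proof -
    have "f 0 j = lmul x ?N (rmul y (?N - j + j) z)"
      by (simp add: f_def lmul_rmul_commute funpow_add del: funpow.simps)
    then show ?thesis
      using that by (simp add: lmul_Suc_eq rmul_Suc_eq mult.assoc del: funpow.simps)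
  qed
  then have "(\<Sum>j\<le>?N. f 0 j) = (\<Sum>j\<le>?N. spow x n * z * spow y n)"
    by (intro sum.cong) auto
  also have "\<dots> = scale (of_nat (Suc ?N)) (spow x n * z * spow y n)"
    by (simp only: sum_constant_scale card_atMost)
  finally have zero: "(\<Sum>j\<le>?N. f 0 j) = scale (of_nat (Suc ?N)) (spow x n * z * spow y n)" .
  have "(\<Sum>i\<le>?N. \<Sum>j\<le>?N. f i j) - (\<Sum>i\<le>n. \<Sum>j\<le>?N. f (Suc i) j) \<in> I"
    by (rule subspace_diff[OF sub total subspace_sum[OF sub pos]])
  then have "(\<Sum>j\<le>?N. f 0 j) \<in> I"
    by (subst (asm) sum.atMost_Suc_shift) (simp del: sum.atMost_Suc)
  then have "scale (inverse (of_nat (Suc ?N))) (scale (of_nat (Suc ?N)) (spow x n * z * spow y n)) \<in> I"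
    unfolding zero by (rule subspace_scale[OF sub])
  moreover have "of_nat (Suc ?N) \<noteq> (0::'f)"
    using char by (simp only: of_nat_eq_0_iff_char_dvd) simp
  ultimately show ?thesis by simp
qed

text \<open>The free factor \<open>z\<close> makes this two-sided: a factor to the right of
  \<open>u\<close> is absorbed by \<open>z\<close>, one to the left by \<open>I\<close>.\<close>

lemma ideal_annihilator_left:
  assumes "ideal I"
  shows "ideal {u. \<forall>z y. u * z * g y \<in> I}"
proof -
  have "u * a * z * g y \<in> I" if "\<forall>z y. u * z * g y \<in> I" for u a z y
    using that[rule_format, of "a * z" y] by (simp add: mult.assoc)
  moreover have "a * u * z * g y \<in> I" if "\<forall>z y. u * z * g y \<in> I" for u a z y
    using assms that by (simp add: ideal_def mult.assoc)
  ultimately show ?thesis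
    using assms unfolding ideal_def subspace_def by (simp add: distrib_right scale_mult_left)
qed

text \<open>Mirror image of the previous argument; \<open>U\<close> will be a set of long
  products.\<close>

lemma ideal_annihilator_right:
  assumes "ideal I"
  shows "ideal {v. \<forall>u\<in>U. \<forall>z. u * z * v \<in> I}"
proof -
  have "u * z * (a * v) \<in> I" if "\<forall>u\<in>U. \<forall>z. u * z * v \<in> I" "u \<in> U" for u z a v
    using bspec[OF that, THEN spec, of "z * a"] by (simp add: mult.assoc)
  moreover have "u * z * (v * a) \<in> I" if "\<forall>u\<in>U. \<forall>z. u * z * v \<in> I" "u \<in> U" for u z a v
    using assms that by (simp add: ideal_def mult.assoc[symmetric])
  ultimately show ?thesis
    using assms unfolding ideal_def subspace_def
    by (auto simp: distrib_left scale_mult_right)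
qed

text \<open>An arbitrary ideal replaces passage to quotients, so that the induction hypothesis
  covers annihilators. The powers of \<open>h\<close> are the scalars that separate homogeneous
  parts.\<close>

theorem nagata_higman:
  assumes char: "CHAR('f) = 0" and h: "(h::'f) \<noteq> 0" "inj (\<lambda>k. h ^ k)"
    and "ideal I" and "\<And>x. spow x n \<in> I"
  shows "\<exists>N>0. \<forall>xs. length xs = N \<longrightarrow> nonempty_prod xs \<in> I"
  using assms(4,5)
proof (induction n arbitrary: I)
  case 0
  then have "nonempty_prod xs \<in> I" if "length xs = 1" for xs
    using that by (auto simp: length_Suc_conv)
  then show ?case by blast
next
  case (Suc n)
  have sub: "subspace I" using Suc.prems(1) by (simp add: ideal_def)
  have "binom_part x y (Suc n) 1 \<in> I" for x y
  proof (rule coeff_in_subspace[OF sub h])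
    fix m
    show "(\<Sum>k\<le>Suc (Suc n). scale ((h ^ m) ^ k) (binom_part x y (Suc n) k)) \<in> I"
      using Suc.prems(2)[of "x + scale (h ^ m) y"] by (simp only: spow_add_scale)
  qed simp
  then have hig: "spow x n * z * spow y n \<in> I" for x y z
    unfolding binom_part_1 by (rule higman_relation[OF Suc.prems(1) char])
  let ?J1 = "{u. \<forall>z y. u * z * spow y n \<in> I}"
  have "spow x n \<in> ?J1" for x
    using hig by simp
  from Suc.IH[OF ideal_annihilator_left[OF Suc.prems(1)] this]
  obtain N1 where N1: "N1 > 0" "\<forall>xs. length xs = N1 \<longrightarrow> nonempty_prod xs \<in> ?J1"
    by (elim exE conjE) (rule that)
  let ?U = "nonempty_prod ` {xs. length xs = N1}"
  let ?J2 = "{v. \<forall>u\<in>?U. \<forall>z. u * z * v \<in> I}"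
  \<comment> \<open>Products of length \<open>N1\<close> now play the role of the left
    power.\<close>
  have "spow x n \<in> ?J2" for x
    using N1(2) by simp
  from Suc.IH[OF ideal_annihilator_right[OF Suc.prems(1)] this]
  obtain N2 where N2: "N2 > 0" "\<forall>ys. length ys = N2 \<longrightarrow> nonempty_prod ys \<in> ?J2"
    by (elim exE conjE) (rule that)
  \<comment> \<open>The extra letter is the middle factor \<open>z\<close>.\<close>
  have "nonempty_prod ws \<in> I" if "length ws = N1 + Suc N2" for ws
  proof -
    define xs where "xs = take N1 ws"
    have "length (drop N1 ws) = Suc N2" using that by simp
    then obtain z ys where ys: "drop N1 ws = z # ys" "length ys = N2"
      by (cases "drop N1 ws") auto
    have xs: "length xs = N1" using that by (simp add: xs_def)
    have "ws = xs @ z # ys" using ys(1) by (metis append_take_drop_id xs_def)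
    then have "nonempty_prod ws = nonempty_prod xs * (z * nonempty_prod ys)"
      using N1(1) N2(1) xs ys(2) nonempty_prod_append[of xs "z # ys"] nonempty_prod_Cons[of ys z]
      by fastforce
    moreover have "nonempty_prod xs * z * nonempty_prod ys \<in> I"
      using N2(2) xs ys(2) by simp
    ultimately show ?thesis by (simp only: mult.assoc)
  qed
  then show ?case by (intro exI[of _ "N1 + Suc N2"]) simp
qed

end

section \<open>Powers of one half in characteristic zero\<close>

text \<open>If \<open>2 ^ i = 2 ^ j\<close> with \<open>i < j\<close>, the positive integer
  \<open>2 ^ (j - i) - 1\<close> would vanish in the field.\<close>

lemma inj_power_half:
  assumes "CHAR('f::field) = 0"
  shows "(2::'f) \<noteq> 0" and "inj (\<lambda>k. inverse (2::'f) ^ k)"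
proof -
  have "of_nat 2 \<noteq> (0::'f)"
    unfolding of_nat_eq_0_iff_char_dvd assms by simp
  then show two: "(2::'f) \<noteq> 0" by simp
  have *: "i = j" if "(2::'f) ^ i = 2 ^ j" "i \<le> j" for i j
  proof -
    have "(2::'f) ^ i * 2 ^ (j - i) = 2 ^ i * 1"
      using that by (metis power_add le_add_diff_inverse mult_1_right)
    then have "(2::'f) ^ (j - i) = 1" using two by (simp only: mult_cancel_left) simp
    then have "of_nat (2 ^ (j - i) - 1) = (0::'f)" by simp
    then have "2 ^ (j - i) - 1 = (0::nat)"
      using assms by (simp only: of_nat_eq_0_iff_char_dvd) simp
    then have "\<not> j - i > 0"
      using one_less_power[of "2::nat" "j - i"] by linarith
    then show ?thesis using that by simp
  qed
  show "inj (\<lambda>k. inverse (2::'f) ^ k)"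
    by (rule injI) (metis * inverse_eq_iff_eq linear power_inverse)
qed

text \<open>Submultiplicativity alone gives no decay; homogeneity under natural multiples, applied
  to \<open>2 ^ m * inverse 2 ^ m = 1\<close>, does.\<close>

lemma (in normed_field) nrm_power_half:
  assumes "CHAR('f) = 0"
  shows "nrm (inverse 2 ^ m) = nrm 1 / 2 ^ m"
proof -
  have "nrm (of_nat (2 ^ m) * inverse 2 ^ m) = of_nat (2 ^ m) * nrm (inverse 2 ^ m)"
    using assms by (rule nrm_of_nat_mult)
  moreover have "of_nat (2 ^ m) * inverse 2 ^ m = (1::'f)"
    using inj_power_half(1)[OF assms] by (simp flip: power_mult_distrib)
  ultimately show ?thesis by (simp add: field_simps)
qed

section \<open>Continuity of the algebra operations\<close>

context metric_algebra
begin

lemma continuous_on_mult: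
  fixes f g :: "'b::topological_space \<Rightarrow> 'a"
  assumes "continuous_on S f" "continuous_on S g"
  shows "continuous_on S (\<lambda>x. f x * g x)"
proof -
  obtain \<gamma> where \<gamma>: "\<gamma> > 0"
    "\<And>a b c :: 'a. dist (a * c) (b * c) \<le> \<gamma> * dist c 0 * dist a b"
    "\<And>a b c :: 'a. dist (c * a) (c * b) \<le> \<gamma> * dist c 0 * dist a b"
    using metric_bounds by blast
  have "((\<lambda>y. f y * g y) \<longlongrightarrow> f x * g x) (at x within S)" if "x \<in> S" for x
  proof -
    let ?F = "at x within S"
    have f: "(f \<longlongrightarrow> f x) ?F" and g: "(g \<longlongrightarrow> g x) ?F"
      using assms that by (auto simp: continuous_on_def)
    have "((\<lambda>y. \<gamma> * dist (g y) 0 * dist (f y) (f x) + \<gamma> * dist (f x) 0 * dist (g y) (g x))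
        \<longlongrightarrow> \<gamma> * dist (g x) 0 * dist (f x) (f x) + \<gamma> * dist (f x) 0 * dist (g x) (g x)) ?F"
      by (intro tendsto_intros f g)
    then have lim: "((\<lambda>y. \<gamma> * dist (g y) 0 * dist (f y) (f x) + \<gamma> * dist (f x) 0 * dist (g y) (g x))
        \<longlongrightarrow> 0) ?F" by simp
    \<comment> \<open>The triangle inequality passes through \<open>f x * g y\<close>, changing one
      factor at a time.\<close>
    have "dist (f y * g y) (f x * g x) \<le>
        \<gamma> * dist (g y) 0 * dist (f y) (f x) + \<gamma> * dist (f x) 0 * dist (g y) (g x)" for y
      using dist_triangle[of "f y * g y" "f x * g x" "f x * g y"] \<gamma>(2)[of "f y" "g y" "f x"]
        \<gamma>(3)[of "f x" "g y" "g x"] by linarith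
    then have "((\<lambda>y. dist (f y * g y) (f x * g x)) \<longlongrightarrow> 0) ?F"
      by (intro tendsto_sandwich[OF always_eventually always_eventually tendsto_const lim]) simp_all
    then show ?thesis by (rule tendsto_dist_iff[THEN iffD2])
  qed
  then show ?thesis by (simp add: continuous_on_def)
qed

lemma continuous_on_spow: "continuous_on UNIV (\<lambda>x::'a. spow x n)"
  by (induction n) (auto intro: continuous_on_mult continuous_on_id)

lemma tendsto_add_scale_power_half:
  assumes "CHAR('f) = 0"
  shows "(\<lambda>m. a + scale (inverse 2 ^ m) b) \<longlonglongrightarrow> a"
proof -
  obtain \<gamma> where \<gamma>: "\<gamma> > 0"
    "\<And>a b c :: 'a. dist (a + c) (b + c) \<le> \<gamma> * dist a b"
    "\<And>r a b. dist (scale r a) (scale r b) \<le> \<gamma> * nrm r * dist a b"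
    using metric_bounds by blast
  let ?c = "\<gamma> * (\<gamma> * nrm 1 * dist b 0)"
  have bound: "dist (a + scale (inverse 2 ^ m) b) a \<le> ?c * (1 / 2) ^ m" for m
  proof -
    have "dist (a + scale (inverse 2 ^ m) b) a \<le> \<gamma> * dist (scale (inverse 2 ^ m) b) 0"
      using \<gamma>(2)[of "scale (inverse 2 ^ m) b" a 0] by (simp add: add.commute)
    also have "\<dots> \<le> \<gamma> * (\<gamma> * nrm (inverse 2 ^ m) * dist b 0)"
      using \<gamma>(1) \<gamma>(3)[of "inverse 2 ^ m" b 0] by (intro mult_left_mono) auto
    also have "\<dots> = ?c * (1 / 2) ^ m"
      unfolding nrm_power_half[OF assms] by (simp add: power_divide)
    finally show ?thesis .
  qed
  have "(\<lambda>m. ?c * (1 / 2) ^ m) \<longlonglongrightarrow> ?c * 0"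
    by (intro tendsto_intros LIMSEQ_power_zero) simp
  then have lim: "(\<lambda>m. ?c * (1 / 2) ^ m) \<longlonglongrightarrow> 0" by simp
  have "(\<lambda>m. dist (a + scale (inverse 2 ^ m) b) a) \<longlonglongrightarrow> 0"
    by (rule tendsto_sandwich[OF always_eventually always_eventually tendsto_const lim])
      (simp_all only: bound zero_le_dist simp_thms)
  then show ?thesis by (rule tendsto_dist_iff[THEN iffD2])
qed

end

section \<open>Baire category and the conclusion\<close>

lemma complete_closed_cover_interior:
  fixes S :: "nat \<Rightarrow> 'a::metric_space set"
  assumes "complete (UNIV :: 'a set)" "\<And>n. closed (S n)" "(\<Union>n. S n) = UNIV"
  obtains n where "interior (S n) \<noteq> {}"
proof -
  have "Met_TC.mcomplete TYPE('a)"
    using assms(1) by (auto simp: Met_TC.mcomplete_def complete_def)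
  then have "interior (\<Union>(range S)) = {}" if "\<And>n. interior (S n) = {}"
    using that assms(2) Met_TC.metric_Baire_category_alt[of "range S"] by auto
  \<comment> \<open>Otherwise the whole space, which is open and nonempty, would have empty
    interior.\<close>
  then show ?thesis using assms(3) that by auto
qed

theorem theorem2p1:
  fixes nrm :: "'f::field \<Rightarrow> real"
    and scale :: "'f \<Rightarrow> 'a::{ring, metric_space} \<Rightarrow> 'a"
  assumes "CHAR('f) = 0"
    and "complete_metric_algebra nrm scale"
    and "nil_algebra TYPE('a)"
  shows "nilpotent_algebra TYPE('a)"
proof -
  interpret complete_metric_algebra nrm scale by fact
  note half = inj_power_half[OF assms(1)]
  have nonzero: "inverse (2::'f) \<noteq> 0" using half(1) by simp
  let ?S = "\<lambda>n. {x::'a. spow x n = 0}"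
  have "closed (?S n)" for n
    by (intro closed_Collect_eq continuous_on_spow continuous_on_const)
  moreover have "(\<Union>n. ?S n) = UNIV"
  proof -
    have "\<exists>n. spow x n = 0" for x :: 'a
      using assms(3) unfolding nil_algebra_def
      by (metis gr0_implies_Suc nonempty_prod_replicate)
    then show ?thesis by auto
  qed
  ultimately obtain n where "interior (?S n) \<noteq> {}"
    using complete_closed_cover_interior[OF complete_algebra] by metis
  then obtain a where a: "a \<in> interior (?S n)" by blast
  have sub: "subspace {0}" by (simp add: subspace_def)
  have "spow b n = 0" for b :: 'a
  proof -
    have "\<forall>\<^sub>F m in sequentially. a + scale (inverse 2 ^ m) b \<in> interior (?S n)"
      using tendsto_add_scale_power_half[OF assms(1)] a by (rule topological_tendstoD[OF _ open_interior])
    then obtain M where "\<And>m. m \<ge> M \<Longrightarrow> spow (a + scale (inverse 2 ^ m) b) n \<in> {0}"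
      unfolding eventually_sequentially using interior_subset by blast
    \<comment> \<open>The degree in the scalar is \<open>Suc n\<close>, so this top coefficient is
      \<open>spow b n\<close>.\<close>
    then have "binom_part a b n (Suc n) \<in> {0}"
      unfolding spow_add_scale by (rule coeff_in_subspace[OF sub nonzero half(2) _ order_refl])
    then show ?thesis by (simp add: binom_part_top)
  qed
  moreover have "ideal {0}" using sub by (simp add: ideal_def)
  ultimately show ?thesis
    using nagata_higman[OF assms(1) nonzero half(2), of "{0}" n]
    unfolding nilpotent_algebra_def by simp
qed

end
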